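(* For every integer $n\ge 0$, the sandpile group of the de Bruijn graph $DB_n$ satisfies $$K(DB_n)\cong\bigoplus_{j=1}^{n-1}\,(\mathbb{Z}/2^j\mathbb{Z})^{2^{\,n-1-j}},$$ where an empty direct sum is the trivial group.
   Context: For a finite directed graph $G=(V,E)$ (loops and multiple edges allowed) with source and target maps $\mathtt{s},\mathtt{t}:E\to V$, the directed line graph $\mathcal{L}G=(E,E_2)$ has vertex set $E$ and edge set $E_2=\{(e_1,e_2)\in E\times E:\mathtt{s}(e_2)=\mathtt{t}(e_1)\}$, with $(e_1,e_2)$ directed from $e_1$ to $e_2$. The de Bruijn graphs are defined by: $DB_0$ is the directed graph with one vertex and two loops, and $DB_n=\mathcal{L}(DB_{n-1})$ for $n\ge1$. Sandpile group: for a strongly connected finite directed graph $G=(V,E)$ and a vertex $v_*$, let $\Delta_v=\sum_{\mathtt{s}(e)=v}(\mathtt{t}(e)-v)\in\mathbb{Z}^V$ for $v\in V$, let $L_V\subset\mathbb{Z}^V$ be the subgroup generated by $v_*$ and $\{\Delta_v\}_{v\neq v_*}$, and define $K(G,v_* )=\mathbb{Z}^V/L_V$. If $G$ is Eulerian (the indegree equals the outdegree at every vertex), the groups $K(G,v_* )$ for different choices of $v_*$ are isomorphic, and the sandpile group is denoted $K(G)$. Each $DB_n$ is strongly connected and Eulerian. *)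

theory Defs
  imports "Graph_Theory.Graph_Theory" "HOL-Algebra.Algebra"
begin

definition line_digraph :: "('a, 'b) pre_digraph \<Rightarrow> ('b, 'b \<times> 'b) pre_digraph" where
  "line_digraph G =
    \<lparr>verts = arcs G,
     arcs = {(e1, e2). e1 \<in> arcs G \<and> e2 \<in> arcs G \<and> tail G e2 = head G e1},
     tail = fst,
     head = snd\<rparr>"

(* Iterating line_digraph changes the type of the graph at every step. The datatype de_bruijn_label
   is a single type in which the iteration can take place: DB_Arc e1 e2 is the pair (e1, e2). *)
datatype de_bruijn_label =
    DB_Vertex
  | DB_Loop bool
  | DB_Arc (db_tail: de_bruijn_label) (db_head: de_bruijn_label)

definition arc_relabelling ::
  "(de_bruijn_label, de_bruijn_label \<times> de_bruijn_label, de_bruijn_label, de_bruijn_label)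
     digraph_isomorphism" where
  "arc_relabelling =
    \<lparr>iso_verts = (\<lambda>v. v),
     iso_arcs = (\<lambda>(e1, e2). DB_Arc e1 e2),
     iso_head = db_head,
     iso_tail = db_tail\<rparr>"

primrec de_bruijn :: "nat \<Rightarrow> (de_bruijn_label, de_bruijn_label) pre_digraph" where
  "de_bruijn 0 =
    \<lparr>verts = {DB_Vertex},
     arcs = {DB_Loop False, DB_Loop True},
     tail = (\<lambda>_. DB_Vertex),
     head = (\<lambda>_. DB_Vertex)\<rparr>"
| "de_bruijn (Suc n) = app_iso arc_relabelling (line_digraph (de_bruijn n))"

lemma digraph_isomorphism_arc_relabelling:
  "pre_digraph.digraph_isomorphism (line_digraph G) arc_relabelling"
  unfolding pre_digraph.digraph_isomorphism_def
  by (auto simp: line_digraph_def arc_relabelling_def wf_digraph_def inj_on_def)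

lemma de_bruijn_Suc_iso: "digraph_iso (line_digraph (de_bruijn n)) (de_bruijn (Suc n))"
  unfolding digraph_iso_def using digraph_isomorphism_arc_relabelling by auto

lemma fin_digraph_de_bruijn: "fin_digraph (de_bruijn n)"
proof (induction n)
  case 0
  show ?case by unfold_locales auto
next
  case (Suc n)
  then interpret fin_digraph "de_bruijn n" .
  have "fin_digraph (line_digraph (de_bruijn n))"
    by unfold_locales
      (auto simp: line_digraph_def intro: finite_subset[of _ "arcs (de_bruijn n) \<times> arcs (de_bruijn n)"])
  from fin_digraph.fin_digraphI_app_iso[OF this digraph_isomorphism_arc_relabelling]
  show ?case by simp
qed

lemma verts_de_bruijn_nonempty: "verts (de_bruijn n) \<noteq> {}"
proof -
  have "verts (de_bruijn n) \<noteq> {} \<and>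
    (\<forall>v \<in> verts (de_bruijn n). \<exists>e \<in> arcs (de_bruijn n). tail (de_bruijn n) e = v)"
  proof (induction n)
    case 0
    show ?case by auto
  next
    case (Suc n)
    interpret fin_digraph "de_bruijn n" by (rule fin_digraph_de_bruijn)
    have "arcs (de_bruijn n) \<noteq> {}" using Suc by blast
    moreover have "\<exists>e' \<in> arcs (de_bruijn n). tail (de_bruijn n) e' = head (de_bruijn n) e"
      if "e \<in> arcs (de_bruijn n)" for e
      using Suc that head_in_verts by blast
    ultimately show ?case
      by (fastforce simp: line_digraph_def arc_relabelling_def)
  qed
  then show ?thesis by blast
qed

(* free_Abelian_group (verts G), written multiplicatively but with (+) as its operation, is Z^V, and
   frag_of v is the basis vector of the vertex v. *)
definition laplacian_row :: "('a, 'b) pre_digraph \<Rightarrow> 'a \<Rightarrow> ('a \<Rightarrow>\<^sub>0 int)" where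
  "laplacian_row G v = (\<Sum>e \<in> out_arcs G v. frag_of (head G e) - frag_of v)"

definition sandpile_lattice :: "('a, 'b) pre_digraph \<Rightarrow> 'a \<Rightarrow> ('a \<Rightarrow>\<^sub>0 int) set" where
  "sandpile_lattice G v\<^sub>0 =
    generate (free_Abelian_group (verts G))
      (insert (frag_of v\<^sub>0) (laplacian_row G ` (verts G - {v\<^sub>0})))"

definition sandpile_group :: "('a, 'b) pre_digraph \<Rightarrow> 'a \<Rightarrow> ('a \<Rightarrow>\<^sub>0 int) set monoid" where
  "sandpile_group G v\<^sub>0 = free_Abelian_group (verts G) Mod sandpile_lattice G v\<^sub>0"

end

theory Submission
  imports Defs
begin

text \<open>
  The vertices of the $n$-th de Bruijn graph are the binary words of length $n$; words are written
  here with the newest letter first, so that an edge prepends a letter and drops the last one. In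
  the sandpile group the class $x_w$ of a word satisfies $2 x_{ua} = x_{0u} + x_{1u}$. For a shorter
  word $r$ let $x_r$ be the sum of all $x_{pr}$ with $pr$ of length $n$. Then

  \<^item> $x_r = x_{0r} + x_{1r}$, by definition, and

  \<^item> $2 x_{ra} = x_r$, by summing the relations at the words $pra$.

  The choice of the sink only translates these classes, so take it first to be $0^n$; then $x_r = 0$
  for every word $r$ of zeros. By the first rule the group is generated by the $y_q = x_{0q}$ with
  $q$ shorter than $n$, and what remains of the relations is $2 y_{qa} = y_q$ together with
  $y_{0 \dots 0} = 0$: a binary tree in which doubling moves towards the root and one branch
  vanishes. Such a tree splits into cyclic groups. Each word $s = u1$ shorter than $n$ leaves the
  all-zero continuation of $u$, and the difference $z_s$ of the two leaves $y_{s0\dots0}$ and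
  $y_{u0\dots0}$ generates a summand of order $2^{n - |s|}$; conversely
  \[ y_q = 2^{n-1-|q|} \sum_s z_s \]
  over the nonempty prefixes $s$ of $q$ that end in 1. There are $2^{n-1-j}$ words $s$ of length
  $n - j$, which is the asserted decomposition.

  Formally, the formula for $y_q$ defines integer coordinates of every vertex, and so a homomorphism
  from $\<int>^V$ to the free abelian group on the words $s$. The lattice is exactly the preimage of
  the tuples whose $s$-entry is divisible by $2^{n-|s|}$ (\<open>L_iff\<close>): the coordinates respect the
  relations (\<open>coordinate_double\<close>), and modulo the lattice every vertex is recovered from its
  coordinates (\<open>expansion\<close>). As the homomorphism is onto (\<open>coordinates_surj\<close>), the first
  isomorphism theorem concludes.
\<close>

section \<open>Subgroups of free abelian groups\<close>

lemma frag_cmul_two: "frag_cmul 2 x = x + x"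
  using frag_cmul_distrib[of 1 1 x] by simp

lemma frag_cmul_diff_distrib2: "frag_cmul k (a - b) = frag_cmul k a - frag_cmul k b"
  by (rule poly_mapping_eqI) (simp add: Poly_Mapping.lookup_minus algebra_simps)

text \<open>
  Congruences modulo the sandpile lattice and divisibility conditions on coordinates are both
  handled as membership of a difference in such a set.
\<close>

locale difference_closed =
  fixes H :: "('a \<Rightarrow>\<^sub>0 int) set"
  assumes zero: "0 \<in> H"
    and diff: "x \<in> H \<Longrightarrow> y \<in> H \<Longrightarrow> x - y \<in> H"
begin

lemma uminus: "x \<in> H \<Longrightarrow> - x \<in> H"
  using diff[OF zero] by fastforce

lemma add: "x \<in> H \<Longrightarrow> y \<in> H \<Longrightarrow> x + y \<in> H"
  using diff[OF _ uminus] by fastforce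

lemma sum: "(\<And>i. i \<in> I \<Longrightarrow> f i \<in> H) \<Longrightarrow> sum f I \<in> H"
  by (induction I rule: infinite_finite_induct) (auto intro: zero add)

lemma cmul: "x \<in> H \<Longrightarrow> frag_cmul k x \<in> H"
proof -
  assume x: "x \<in> H"
  have nat: "frag_cmul (int m) x \<in> H" for m
    by (induction m) (auto simp: frag_cmul_distrib intro: zero add x)
  show ?thesis
    using nat[of "nat k"] uminus[OF nat[of "nat (- k)"]] by (cases "k \<ge> 0") auto
qed

lemma frag_extend:
  assumes "\<And>x. x \<in> Poly_Mapping.keys a \<Longrightarrow> frag_cmul (Poly_Mapping.lookup a x) (f x) \<in> H"
  shows "frag_extend f a \<in> H"
  unfolding frag_extend_def using assms by (rule sum)

end

lemma difference_closed_subgroup: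
  assumes "subgroup H (free_Abelian_group S)"
  shows "difference_closed H"
proof
  interpret subgroup H "free_Abelian_group S" by fact
  show "0 \<in> H" using one_closed by simp
  fix x y assume xy: "x \<in> H" "y \<in> H"
  have "x \<otimes>\<^bsub>free_Abelian_group S\<^esub> inv\<^bsub>free_Abelian_group S\<^esub> y \<in> H"
    using xy by (intro m_closed m_inv_closed)
  moreover have "Poly_Mapping.keys y \<subseteq> S"
    using xy(2) subset by (metis carrier_free_Abelian_group_iff subsetD)
  ultimately show "x - y \<in> H" by simp
qed

section \<open>Integer coordinates of binary words\<close>

text \<open>
  A letter \<open>True\<close> is where \<open>q\<close>, read as a path from the root of the binary tree, leaves an
  all-zero continuation; the prefix that ends there names the cyclic summand that is entered.
\<close>

definition branch_sum :: "bool list \<Rightarrow> (bool list \<Rightarrow>\<^sub>0 int)" where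
  "branch_sum q = (\<Sum>i | i < length q \<and> q ! i. frag_of (take (Suc i) q))"

lemma branch_sum_Nil [simp]: "branch_sum [] = 0"
  by (simp add: branch_sum_def)

lemma branch_sum_snoc:
  "branch_sum (q @ [a]) = branch_sum q + (if a then frag_of (q @ [True]) else 0)"
proof -
  have "{i. i < length (q @ [a]) \<and> (q @ [a]) ! i} =
      {i. i < length q \<and> q ! i} \<union> (if a then {length q} else {})"
    by (auto simp: nth_append less_Suc_eq)
  then show ?thesis
    by (auto simp: branch_sum_def sum.union_disjoint)
qed

lemma branch_sum_append_zeros [simp]: "branch_sum (q @ replicate k False) = branch_sum q"
proof (induction k)
  case (Suc k)
  have "q @ replicate (Suc k) False = (q @ replicate k False) @ [False]"
    by (simp add: replicate_append_same)
  then show ?case using Suc by (simp only: branch_sum_snoc) simp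
qed simp

definition branch_words :: "nat \<Rightarrow> bool list set" where
  "branch_words n = {u @ [True] |u. length u + 1 < n}"

lemma keys_branch_sum: "length q < n \<Longrightarrow> Poly_Mapping.keys (branch_sum q) \<subseteq> branch_words n"
proof (induction q rule: rev_induct)
  case (snoc a q)
  then show ?case
    using keys_add[of "branch_sum q" "frag_of (q @ [True])"]
    by (auto simp: branch_sum_snoc branch_words_def)
qed simp

text \<open>
  The recursion is $x_{0r} = y_r$ and $x_{1r} = x_r - y_r$, with $y_r$ given by its expansion in the
  generators of the cyclic summands and $x$ of the empty word equal to 0.
\<close>

fun coordinate :: "nat \<Rightarrow> bool list \<Rightarrow> (bool list \<Rightarrow>\<^sub>0 int)" where
  "coordinate n [] = 0"
| "coordinate n (c # r) =
    (if c then coordinate n r - frag_cmul (2 ^ (n - 1 - length r)) (branch_sum r)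
     else frag_cmul (2 ^ (n - 1 - length r)) (branch_sum r))"

lemma keys_coordinate: "length r \<le> n \<Longrightarrow> Poly_Mapping.keys (coordinate n r) \<subseteq> branch_words n"
proof (induction r)
  case (Cons c r)
  let ?y = "frag_cmul (2 ^ (n - 1 - length r)) (branch_sum r)"
  have "Poly_Mapping.keys ?y \<subseteq> branch_words n"
    using keys_branch_sum[of r n] Cons.prems keys_cmul by fastforce
  moreover have "Poly_Mapping.keys (coordinate n r) \<subseteq> branch_words n"
    using Cons by simp
  ultimately show ?case
    using keys_diff[of "coordinate n r" ?y] by auto
qed simp

text \<open>
  Among the combinations of \<open>branch_words n\<close>, these are the relations of the target direct sum,
  in which the summand of \<open>s\<close> is cyclic of order $2^{n - |s|}$.
\<close>

definition relation_lattice :: "nat \<Rightarrow> (bool list \<Rightarrow>\<^sub>0 int) set" where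
  "relation_lattice n = {c. \<forall>s. 2 ^ (n - length s) dvd Poly_Mapping.lookup c s}"

interpretation relation_lattice: difference_closed "relation_lattice n" for n
  by unfold_locales (auto simp: relation_lattice_def Poly_Mapping.lookup_minus)

lemma frag_cmul_in_relation_lattice: "frag_cmul (2 ^ (n - length s)) (frag_of s) \<in> relation_lattice n"
  by (auto simp: relation_lattice_def)

text \<open>
  The coordinates satisfy $2 x_{ra} = x_r$ in the direct sum. Lengthening $q$ by a letter halves the
  factor in front of the branch sum of $q$, so doubling restores it, and the one new summand that a
  letter 1 brings in is multiplied by exactly its order.
\<close>

lemma coordinate_double:
  "length r < n \<Longrightarrow> frag_cmul 2 (coordinate n (r @ [a])) - coordinate n r \<in> relation_lattice n"
proof (induction r)
  case Nil
  show ?case by (simp add: relation_lattice.zero)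
next
  case (Cons c r)
  let ?y = "\<lambda>r. frag_cmul (2 ^ (n - 1 - length r)) (branch_sum r)"
  have "Suc (n - 1 - length (r @ [a])) = n - 1 - length r" using Cons.prems by simp
  then have p: "2 * (2::int) ^ (n - 1 - length (r @ [a])) = 2 ^ (n - 1 - length r)"
    by (metis power_Suc)
  have "frag_cmul 2 (?y (r @ [a])) - ?y r =
      (if a then frag_cmul (2 ^ (n - length (r @ [a]))) (frag_of (r @ [a])) else 0)"
    unfolding frag_cmul_cmul p by (simp add: branch_sum_snoc frag_cmul_distrib2)
  then have y: "frag_cmul 2 (?y (r @ [a])) - ?y r \<in> relation_lattice n"
    using frag_cmul_in_relation_lattice[of n "r @ [a]"] relation_lattice.zero[of n]
    by (cases a) simp_all
  show ?case
  proof (cases c)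
    case True
    have "frag_cmul 2 (coordinate n ((c # r) @ [a])) - coordinate n (c # r) =
      (frag_cmul 2 (coordinate n (r @ [a])) - coordinate n r) - (frag_cmul 2 (?y (r @ [a])) - ?y r)"
      using True by (simp add: frag_cmul_diff_distrib2 del: frag_cmul_cmul)
    then show ?thesis using relation_lattice.diff[OF _ y] Cons by simp
  next
    case False
    then show ?thesis using y by simp
  qed
qed

text \<open>
  The relations between the cylinder classes \<open>F r\<close> modulo a subgroup \<open>H\<close>, after a
  translation that puts the all-zero word into \<open>H\<close>.
\<close>

locale doubling_family = difference_closed H for H :: "('a \<Rightarrow>\<^sub>0 int) set" +
  fixes n :: nat and F :: "bool list \<Rightarrow> ('a \<Rightarrow>\<^sub>0 int)"
  assumes split: "length r < n \<Longrightarrow> F r = F (False # r) + F (True # r)"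
    and double: "length r < n \<Longrightarrow> frag_cmul 2 (F (r @ [a])) - F r \<in> H"
    and origin: "F (replicate n False) \<in> H"
begin

lemma repeated_double:
  "length r + length p \<le> n \<Longrightarrow> frag_cmul (2 ^ length p) (F (r @ p)) - F r \<in> H"
proof (induction p rule: rev_induct)
  case Nil
  show ?case by (simp add: zero)
next
  case (snoc a p)
  have "frag_cmul (2 ^ length (p @ [a])) (F (r @ p @ [a])) - F r =
     frag_cmul (2 ^ length p) (frag_cmul 2 (F ((r @ p) @ [a])) - F (r @ p)) +
     (frag_cmul (2 ^ length p) (F (r @ p)) - F r)"
    by (simp add: frag_cmul_diff_distrib2 mult.commute)
  moreover have "frag_cmul 2 (F ((r @ p) @ [a])) - F (r @ p) \<in> H"
    using snoc.prems by (intro double) simp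
  moreover have "frag_cmul (2 ^ length p) (F (r @ p)) - F r \<in> H"
    using snoc by simp
  ultimately show ?case by (metis add cmul)
qed

lemma zeros: "k \<le> n \<Longrightarrow> F (replicate k False) \<in> H"
proof -
  assume k: "k \<le> n"
  have "frag_cmul (2 ^ (n - k)) (F (replicate n False)) - F (replicate k False) \<in> H"
    using repeated_double[of "replicate k False" "replicate (n - k) False"] k
    by (simp flip: replicate_add)
  from diff[OF cmul[OF origin, of "2 ^ (n - k)"] this] show ?thesis by simp
qed

text \<open>
  The difference between the all-zero continuation of \<open>s\<close> and that of its parent, both taken at
  full length, where no power of 2 has been lost.
\<close>

definition branch_generator :: "bool list \<Rightarrow> ('a \<Rightarrow>\<^sub>0 int)" where
  "branch_generator s =
    F (False # s @ replicate (n - 1 - length s) False) -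
    F (False # butlast s @ replicate (n - length s) False)"

text \<open>
  Doubling $n - |s|$ times brings both continuations back to the common parent of \<open>s\<close>.
\<close>

lemma cmul_branch_generator:
  assumes "s \<in> branch_words n"
  shows "frag_cmul (2 ^ (n - length s)) (branch_generator s) \<in> H"
proof -
  obtain u where u: "s = u @ [True]" "length u + 1 < n"
    using assms by (auto simp: branch_words_def)
  then have p: "(2::int) ^ (n - length s) = 2 * 2 ^ (n - 1 - length s)"
    by (simp flip: power_Suc add: Suc_diff_Suc)
  have "frag_cmul (2 ^ (n - length s)) (F (False # s @ replicate (n - 1 - length s) False)) - F (False # u) \<in> H"
    using repeated_double[of "False # u" "True # replicate (n - 1 - length s) False"] u p by simp
  moreover have "frag_cmul (2 ^ (n - length s)) (F (False # u @ replicate (n - length s) False)) - F (False # u) \<in> H"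
    using repeated_double[of "False # u" "replicate (n - length s) False"] u by simp
  ultimately show ?thesis
    using diff u by (fastforce simp: branch_generator_def frag_cmul_diff_distrib2)
qed

text \<open>
  The expansion of $y_q$ telescopes along \<open>q\<close>. A letter 0 only changes the number of trailing
  zeros, which is why the statement allows \<open>k\<close> of them; a letter 1 replaces one all-zero
  continuation by another, at the cost of a multiple of a generator.
\<close>

lemma expansion_False:
  "length q + k < n \<Longrightarrow>
    F (False # q @ replicate k False) -
      frag_cmul (2 ^ (n - 1 - length q - k)) (frag_extend branch_generator (branch_sum q)) \<in> H"
proof (induction q arbitrary: k rule: rev_induct)
  case Nil
  then show ?case using zeros[of "Suc k"] by simp
next
  case (snoc a q)
  let ?m = "n - 1 - length (q @ [a]) - k"
  let ?B = "\<lambda>q. frag_extend branch_generator (branch_sum q)"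
  have IH: "F (False # q @ replicate (Suc k) False) - frag_cmul (2 ^ ?m) (?B q) \<in> H"
    using snoc.IH[of "Suc k"] snoc.prems by simp
  show ?case
  proof (cases a)
    case False
    then show ?thesis using IH by (simp add: branch_sum_snoc)
  next
    case True
    let ?s = "q @ [True]"
    have A: "frag_cmul (2 ^ ?m) (F (False # ?s @ replicate (n - 1 - length ?s) False)) - F (False # ?s @ replicate k False) \<in> H"
      using repeated_double[of "False # ?s @ replicate k False" "replicate ?m False"] snoc.prems
      by (simp flip: replicate_add)
    have B: "frag_cmul (2 ^ ?m) (F (False # q @ replicate (n - length ?s) False)) - F (False # q @ replicate (Suc k) False) \<in> H"
      using repeated_double[of "False # q @ replicate (Suc k) False" "replicate ?m False"] snoc.prems
      by (simp flip: replicate_add replicate_Suc add: Suc_diff_Suc)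
    have *: "frag_cmul (2 ^ ?m) (branch_generator ?s) - F (False # ?s @ replicate k False)
        + F (False # q @ replicate (Suc k) False) \<in> H"
      using diff[OF A B] by (simp add: branch_generator_def frag_cmul_diff_distrib2 algebra_simps)
    have "F (False # ?s @ replicate k False) - frag_cmul (2 ^ ?m) (?B ?s) =
      (F (False # q @ replicate (Suc k) False) - frag_cmul (2 ^ ?m) (?B q)) -
      (frag_cmul (2 ^ ?m) (branch_generator ?s) - F (False # ?s @ replicate k False)
        + F (False # q @ replicate (Suc k) False))"
      by (simp add: branch_sum_snoc frag_extend_add frag_cmul_distrib2)
    also have "\<dots> \<in> H" by (rule diff[OF IH *])
    finally show ?thesis using True by simp
  qed
qed

lemma expansion:
  "length r \<le> n \<Longrightarrow> F r - frag_extend branch_generator (coordinate n r) \<in> H"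
proof (induction r)
  case Nil
  then show ?case using zeros[of 0] by simp
next
  case (Cons c r)
  let ?y = "frag_cmul (2 ^ (n - 1 - length r)) (branch_sum r)"
  have F: "F (False # r) - frag_extend branch_generator ?y \<in> H"
    using expansion_False[of r 0] Cons.prems by (simp add: frag_extend_cmul)
  show ?case
  proof (cases c)
    case True
    have "F (True # r) - frag_extend branch_generator (coordinate n (True # r)) =
      (F r - frag_extend branch_generator (coordinate n r)) - (F (False # r) - frag_extend branch_generator ?y)"
      using split[of r] Cons.prems by (simp add: frag_extend_diff)
    then show ?thesis using diff[OF _ F] Cons True by simp
  next
    case False
    then show ?thesis using F by simp
  qed
qed

end


section \<open>De Bruijn graphs as graphs of words\<close>

definition words :: "nat \<Rightarrow> bool list set" where
  "words m = {r. length r = m}"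

lemma finite_words [simp]: "finite (words m)"
  and card_words: "card (words m) = 2 ^ m"
  using finite_lists_length_eq[of "UNIV :: bool set" m] card_lists_length_eq[of "UNIV :: bool set" m]
  by (simp_all add: words_def)

lemma sum_words_Cons: "sum f (words (Suc m)) = (\<Sum>r\<in>words m. f (False # r) + f (True # r))"
proof -
  have "words (Suc m) = Cons False ` words m \<union> Cons True ` words m"
    by (auto simp: words_def length_Suc_conv image_iff)
  moreover have "Cons False ` words m \<inter> Cons True ` words m = {}" by auto
  ultimately show ?thesis
    by (simp add: sum.union_disjoint sum.reindex sum.distrib)
qed

lemma sum_words_snoc:
  "sum f (words (Suc m)) = (\<Sum>r\<in>words m. f (r @ [False]) + f (r @ [True]))"
proof -
  have "words (Suc m) = (\<lambda>r. r @ [False]) ` words m \<union> (\<lambda>r. r @ [True]) ` words m"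
    by (auto simp: words_def length_Suc_conv_rev image_iff)
  moreover have "(\<lambda>r. r @ [False]) ` words m \<inter> (\<lambda>r. r @ [True]) ` words m = {}" by auto
  ultimately show ?thesis
    by (simp add: sum.union_disjoint sum.reindex sum.distrib inj_on_def)
qed

text \<open>
  An edge of one de Bruijn graph is a vertex of the next, so one labelling serves for both: a word
  names a vertex of the graph indexed by its length, and an edge of the preceding graph. The edge
  runs from its word without the newest letter to its word without the oldest one.
\<close>

function (sequential) label :: "bool list \<Rightarrow> de_bruijn_label" where
  "label [] = DB_Vertex"
| "label [c] = DB_Loop c"
| "label (a # b # r) = DB_Arc (label (b # r)) (label (butlast (a # b # r)))"
  by pat_completeness auto
termination by (relation "measure length") auto

lemma label_eq_iff: "length r = length r' \<Longrightarrow> label r = label r' \<longleftrightarrow> r = r'"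
proof (induction r arbitrary: r' rule: label.induct)
  case (3 a b r)
  then obtain a' b' q where r': "r' = a' # b' # q"
    by (metis length_Suc_conv)
  show ?case
  proof
    assume *: "label (a # b # r) = label r'"
    have len: "length r = length q" using 3 r' by simp
    have "b # r = b' # q" using * r' 3(1)[of "b' # q"] len by simp
    moreover have "butlast (a # b # r) = butlast (a' # b' # q)"
      using * r' 3(2)[of "butlast (a' # b' # q)"] len by (simp del: butlast.simps)
    ultimately show "a # b # r = r'" using r' by simp
  qed auto
next
  case (2 c)
  then obtain c' where "r' = [c']"
    by (metis length_0_conv length_Suc_conv)
  then show ?case by simp
qed simp

lemma inj_on_label: "inj_on label (words m)"
  by (auto simp: inj_on_def words_def label_eq_iff)

lemma label_arc: "2 \<le> length r \<Longrightarrow> label r = DB_Arc (label (tl r)) (label (butlast r))"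
  by (cases r rule: label.cases) auto

lemma de_bruijn_words:
  "verts (de_bruijn n) = label ` words n \<and> arcs (de_bruijn n) = label ` words (Suc n) \<and>
    (\<forall>r \<in> words (Suc n). tail (de_bruijn n) (label r) = label (tl r) \<and>
       head (de_bruijn n) (label r) = label (butlast r))"
proof (induction n)
  case 0
  have "words (Suc 0) = {[False], [True]}"
    by (auto simp: words_def length_Suc_conv)
  then show ?case by (auto simp: words_def)
next
  case (Suc n)
  let ?D = "de_bruijn n"
  have "{(e1, e2). e1 \<in> arcs ?D \<and> e2 \<in> arcs ?D \<and> tail ?D e2 = head ?D e1} =
      (\<lambda>r. (label (tl r), label (butlast r))) ` words (Suc (Suc n))"
  proof (intro equalityI subsetI; clarify)
    fix e1 e2
    assume e: "e1 \<in> arcs ?D" "e2 \<in> arcs ?D" and eq: "tail ?D e2 = head ?D e1"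
    obtain r1 r2 where r: "e1 = label r1" "e2 = label r2" "r1 \<in> words (Suc n)" "r2 \<in> words (Suc n)"
      using e Suc by auto
    then have "tl r2 = butlast r1"
      using eq Suc by (auto simp: words_def label_eq_iff)
    moreover have "r1 \<noteq> []" "r2 \<noteq> []" using r by (auto simp: words_def)
    ultimately have "butlast (hd r2 # r1) = r2"
      by (metis butlast.simps(2) list.collapse)
    then show "(e1, e2) \<in> (\<lambda>r. (label (tl r), label (butlast r))) ` words (Suc (Suc n))"
      using r by (intro image_eqI[of _ _ "hd r2 # r1"]) (auto simp: words_def)
  next
    fix r assume r: "r \<in> words (Suc (Suc n))"
    have "tl r \<in> words (Suc n)" "butlast r \<in> words (Suc n)"
      using r by (auto simp: words_def)
    then show "label (tl r) \<in> arcs ?D \<and> label (butlast r) \<in> arcs ?D \<and>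
        tail ?D (label (butlast r)) = head ?D (label (tl r))"
      using Suc by (simp add: butlast_tl)
  qed
  moreover have "(\<lambda>r. DB_Arc (label (tl r)) (label (butlast r))) ` words (Suc (Suc n)) =
      label ` words (Suc (Suc n))"
    by (intro image_cong refl) (simp add: words_def label_arc)
  moreover have "db_tail (label r) = label (tl r)" "db_head (label r) = label (butlast r)"
    if "r \<in> words (Suc (Suc n))" for r
    using label_arc[of r] that by (simp_all add: words_def)
  ultimately show ?case
    using Suc by (simp add: app_iso_def arc_relabelling_def line_digraph_def image_image)
qed

lemma laplacian_row_label:
  assumes r: "r \<in> words n"
  shows "laplacian_row (de_bruijn n) (label r) =
    frag_of (label (butlast (False # r))) + frag_of (label (butlast (True # r))) -
    frag_cmul 2 (frag_of (label r))"
proof -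
  let ?D = "de_bruijn n"
  have c: "c # r \<in> words (Suc n)" for c using r by (simp add: words_def)
  have "out_arcs ?D (label r) = label ` {z \<in> words (Suc n). label (tl z) = label r}"
    using de_bruijn_words[of n] by (auto simp: out_arcs_def)
  also have "{z \<in> words (Suc n). label (tl z) = label r} = {False # r, True # r}"
    using r by (auto simp: words_def label_eq_iff length_Suc_conv)
  finally have "out_arcs ?D (label r) = {label (False # r), label (True # r)}" by simp
  moreover have "label (False # r) \<noteq> label (True # r)" by (simp add: label_eq_iff)
  ultimately show ?thesis
    using de_bruijn_words[of n] c by (simp add: laplacian_row_def frag_cmul_two)
qed

text \<open>
  Every vertex has two incoming and two outgoing edges, so in the sum of all rows each basis vector
  cancels. This puts the row of the sink, which is not among the generators, into the lattice.
\<close>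

lemma sum_laplacian_rows: "(\<Sum>r\<in>words n. laplacian_row (de_bruijn n) (label r)) = 0"
proof -
  let ?e = "\<lambda>r. frag_of (label r)"
  have "(\<Sum>r\<in>words n. ?e (butlast (False # r)) + ?e (butlast (True # r))) =
      (\<Sum>z\<in>words (Suc n). ?e (butlast z))"
    by (simp only: sum_words_Cons)
  also have "\<dots> = (\<Sum>r\<in>words n. ?e r + ?e r)"
    by (simp add: sum_words_snoc)
  also have "\<dots> = (\<Sum>r\<in>words n. frag_cmul 2 (?e r))"
    by (simp add: frag_cmul_two)
  finally show ?thesis
    by (simp add: laplacian_row_label sum_subtractf cong: sum.cong)
qed

section \<open>The sandpile lattice as a preimage, and the sandpile group\<close>

locale de_bruijn_sandpile =
  fixes n :: nat and v :: "bool list"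
  assumes v: "v \<in> words n"
begin

abbreviation "V \<equiv> verts (de_bruijn n)"
abbreviation "L \<equiv> sandpile_lattice (de_bruijn n) (label v)"
abbreviation "basis r \<equiv> frag_of (label r)"

lemma V: "V = label ` words n"
  using de_bruijn_words by blast

lemma laplacian_row_carrier:
  "r \<in> words n \<Longrightarrow> laplacian_row (de_bruijn n) (label r) \<in> carrier (free_Abelian_group V)"
proof -
  assume r: "r \<in> words n"
  have "butlast (c # r) \<in> words n" for c using r by (cases r) (auto simp: words_def)
  then have "Poly_Mapping.keys (basis (butlast (c # r))) \<subseteq> V" for c using V by auto
  moreover have "Poly_Mapping.keys (frag_cmul 2 (basis r)) \<subseteq> V" using r V by auto
  ultimately show ?thesis
    unfolding laplacian_row_label[OF r] carrier_free_Abelian_group_iff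
    by (meson Un_least keys_add keys_diff order_trans)
qed

lemma subgroup_L: "subgroup L (free_Abelian_group V)"
  unfolding sandpile_lattice_def
proof (rule group.generate_is_subgroup)
  show "insert (basis v) (laplacian_row (de_bruijn n) ` (V - {label v})) \<subseteq> carrier (free_Abelian_group V)"
    using laplacian_row_carrier v V by auto
qed simp

sublocale difference_closed L
  using subgroup_L by (rule difference_closed_subgroup)

lemma basis_v_in_L: "basis v \<in> L"
  unfolding sandpile_lattice_def by (rule generate.incl) simp

lemma laplacian_row_in_L:
  assumes "r \<in> words n"
  shows "laplacian_row (de_bruijn n) (label r) \<in> L"
proof (cases "r = v")
  case False
  then have "label r \<in> V - {label v}"
    using assms v V by (auto simp: words_def label_eq_iff)
  then show ?thesis
    unfolding sandpile_lattice_def by (intro generate.incl) blast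
next
  case True
  let ?row = "\<lambda>r. laplacian_row (de_bruijn n) (label r)"
  have "label r \<in> V - {label v}" if "r \<in> words n - {v}" for r
    using that v V by (auto simp: words_def label_eq_iff)
  then have "(\<Sum>r\<in>words n - {v}. ?row r) \<in> L"
    unfolding sandpile_lattice_def by (intro sum[unfolded sandpile_lattice_def] generate.incl) blast
  moreover have "?row v + (\<Sum>r\<in>words n - {v}. ?row r) = 0"
    using sum_laplacian_rows[of n] sum.remove[OF finite_words v, of ?row] by simp
  ultimately show ?thesis
    using uminus True by (metis eq_neg_iff_add_eq_0)
qed

definition cylinder :: "bool list \<Rightarrow> (de_bruijn_label \<Rightarrow>\<^sub>0 int)" where
  "cylinder r = (\<Sum>p\<in>words (n - length r). basis (p @ r))"

text \<open>
  Each of the $2^{n-|r|}$ words in a cylinder is translated by the all-zero word.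
\<close>

definition centred_cylinder :: "bool list \<Rightarrow> (de_bruijn_label \<Rightarrow>\<^sub>0 int)" where
  "centred_cylinder r = cylinder r - frag_cmul (2 ^ (n - length r)) (basis (replicate n False))"

lemma centred_cylinder_word:
  "r \<in> words n \<Longrightarrow> centred_cylinder r = basis r - basis (replicate n False)"
  by (simp add: centred_cylinder_def cylinder_def words_def)

lemma cylinder_split:
  "length r < n \<Longrightarrow> cylinder r = cylinder (False # r) + cylinder (True # r)"
  using sum_words_snoc[of "\<lambda>p. basis (p @ r)" "n - Suc (length r)"]
  by (simp add: cylinder_def Suc_diff_Suc sum.distrib)

lemma cylinder_double:
  assumes "length r < n"
  shows "frag_cmul 2 (cylinder (r @ [a])) - cylinder r \<in> L"
proof -
  let ?m = "n - Suc (length r)"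
  have w: "p @ r @ [a] \<in> words n" if "p \<in> words ?m" for p
    using that assms by (simp add: words_def)
  have "cylinder r = (\<Sum>p\<in>words ?m. basis (False # p @ r) + basis (True # p @ r))"
    using sum_words_Cons[of "\<lambda>p. basis (p @ r)" ?m] assms
    by (simp add: cylinder_def Suc_diff_Suc)
  also have "\<dots> - frag_cmul 2 (cylinder (r @ [a])) =
      (\<Sum>p\<in>words ?m. laplacian_row (de_bruijn n) (label (p @ r @ [a])))"
    by (simp add: cylinder_def frag_cmul_sum sum_subtractf laplacian_row_label w butlast_append cong: sum.cong)
  also have "\<dots> \<in> L"
    using w by (intro sum laplacian_row_in_L)
  finally show ?thesis using uminus by fastforce
qed

sublocale doubling_family L n centred_cylinder
proof
  let ?o = "basis (replicate n False)"
  have pow: "(2::int) ^ (n - length r) = 2 * 2 ^ (n - Suc (length r))" if "length r < n" for r :: "bool list"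
    using that by (simp flip: power_Suc add: Suc_diff_Suc)
  show "centred_cylinder r = centred_cylinder (False # r) + centred_cylinder (True # r)"
    if "length r < n" for r
    using cylinder_split[OF that] pow[OF that] frag_cmul_distrib[of "2 ^ (n - Suc (length r))" "2 ^ (n - Suc (length r))" ?o]
    by (simp add: centred_cylinder_def)
  show "frag_cmul 2 (centred_cylinder (r @ [a])) - centred_cylinder r \<in> L"
    if "length r < n" for r a
    using cylinder_double[OF that, of a] pow[OF that]
    by (simp add: centred_cylinder_def frag_cmul_diff_distrib2)
  show "centred_cylinder (replicate n False) \<in> L"
    using zero by (simp add: centred_cylinder_word words_def)
qed

definition unlabel :: "de_bruijn_label \<Rightarrow> bool list" where
  "unlabel = the_inv_into (words n) label"

lemma unlabel [simp]: "r \<in> words n \<Longrightarrow> unlabel (label r) = r"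
  unfolding unlabel_def by (rule the_inv_into_f_f[OF inj_on_label])

text \<open>
  Subtracting the coordinates of the sink makes the sink vanish and changes no Laplacian row, since
  the coefficients of a row add up to 0. Hence one set of coordinates serves every sink.
\<close>

definition coordinates :: "(de_bruijn_label \<Rightarrow>\<^sub>0 int) \<Rightarrow> (bool list \<Rightarrow>\<^sub>0 int)" where
  "coordinates = frag_extend (\<lambda>x. coordinate n (unlabel x) - coordinate n v)"

lemma coordinates_basis:
  "r \<in> words n \<Longrightarrow> coordinates (basis r) = coordinate n r - coordinate n v"
  by (simp add: coordinates_def)

lemma keys_coordinates:
  assumes "Poly_Mapping.keys a \<subseteq> V"
  shows "Poly_Mapping.keys (coordinates a) \<subseteq> branch_words n"
  using assms
proof (induction rule: free_Abelian_group_induct[consumes 1, case_names 1 2 3])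
  case 1
  show ?case by (simp add: coordinates_def)
next
  case (2 x y)
  then show ?case
    using keys_diff[of "coordinates x" "coordinates y"] by (auto simp: coordinates_def frag_extend_diff)
next
  case (3 x)
  then obtain r where r: "x = label r" "r \<in> words n" using V by auto
  have "Poly_Mapping.keys (coordinate n u) \<subseteq> branch_words n" if "u \<in> words n" for u
    using keys_coordinate that by (simp add: words_def)
  from this[OF r(2)] this[OF v] show ?case
    unfolding r(1) coordinates_basis[OF r(2)] by (rule order_trans[OF keys_diff Un_least])
qed

lemma coordinates_laplacian_row:
  assumes r: "r \<in> words n"
  shows "coordinates (laplacian_row (de_bruijn n) (label r)) \<in> relation_lattice n"
proof -
  have w: "butlast (c # r) \<in> words n" for c using r by (cases r) (auto simp: words_def)
  have "coordinates (laplacian_row (de_bruijn n) (label r)) =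
      coordinates (basis (butlast (False # r))) + coordinates (basis (butlast (True # r))) -
      frag_cmul 2 (coordinates (basis r))"
    by (simp only: laplacian_row_label[OF r] coordinates_def frag_extend_add frag_extend_diff frag_extend_cmul)
  also have "\<dots> = coordinate n (butlast (False # r)) + coordinate n (butlast (True # r)) -
      frag_cmul 2 (coordinate n r)"
    unfolding coordinates_basis[OF r] coordinates_basis[OF w]
    by (simp add: frag_cmul_two)
  also have "\<dots> \<in> relation_lattice n"
  proof (cases r rule: rev_cases)
    case Nil
    then show ?thesis by (simp add: relation_lattice.zero)
  next
    case (snoc q a)
    then have "length q < n" using r by (simp add: words_def)
    from relation_lattice.uminus[OF coordinate_double[OF this, of a]]
    show ?thesis using snoc by simp
  qed
  finally show ?thesis .
qed

lemma coordinates_L: "a \<in> L \<Longrightarrow> coordinates a \<in> relation_lattice n"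
  unfolding sandpile_lattice_def
proof (induction rule: generate.induct)
  case one
  show ?case by (simp add: coordinates_def relation_lattice.zero)
next
  case *: (incl h)
  then show ?case
    using v V coordinates_laplacian_row by (auto simp: coordinates_basis relation_lattice.zero)
next
  case *: (inv h)
  then have "h \<in> carrier (free_Abelian_group V)"
    using v V laplacian_row_carrier by auto
  moreover have "coordinates h \<in> relation_lattice n"
    using * v V coordinates_laplacian_row by (auto simp: coordinates_basis relation_lattice.zero)
  ultimately show ?case
    using relation_lattice.uminus by (simp add: coordinates_def frag_extend_minus)
next
  case (eng h1 h2)
  then show ?case
    using relation_lattice.add by (simp add: coordinates_def frag_extend_add)
qed

text \<open>
  For a single vertex $r$ the difference of the expansions of $r$ and of the sink expresses their
  difference, from which the all-zero word has cancelled, and the sink itself lies in the lattice.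
\<close>

lemma coordinates_reconstruct:
  assumes "Poly_Mapping.keys a \<subseteq> V"
  shows "a - frag_extend branch_generator (coordinates a) \<in> L"
  using assms
proof (induction rule: free_Abelian_group_induct[consumes 1, case_names 1 2 3])
  case 1
  show ?case by (simp add: coordinates_def zero)
next
  case (2 x y)
  from diff[OF "2.IH"] show ?case
    by (simp add: coordinates_def frag_extend_diff algebra_simps)
next
  case (3 x)
  then obtain r where r: "x = label r" "r \<in> words n" using V by auto
  let ?E = "\<lambda>r. centred_cylinder r - frag_extend branch_generator (coordinate n r)"
  have "?E r - ?E v + basis v \<in> L"
    using r v by (intro add diff expansion basis_v_in_L) (auto simp: words_def)
  then show ?case
    using r v by (simp add: coordinates_basis frag_extend_diff centred_cylinder_word algebra_simps)
qed

lemma L_iff: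
  assumes "Poly_Mapping.keys a \<subseteq> V"
  shows "a \<in> L \<longleftrightarrow> coordinates a \<in> relation_lattice n"
proof
  assume c: "coordinates a \<in> relation_lattice n"
  have "frag_extend branch_generator (coordinates a) \<in> L"
  proof (rule frag_extend)
    fix s assume s: "s \<in> Poly_Mapping.keys (coordinates a)"
    obtain m where "Poly_Mapping.lookup (coordinates a) s = m * 2 ^ (n - length s)"
      using c by (auto simp: relation_lattice_def dvd_def mult.commute)
    moreover have "s \<in> branch_words n" using s keys_coordinates[OF assms] by blast
    ultimately show "frag_cmul (Poly_Mapping.lookup (coordinates a) s) (branch_generator s) \<in> L"
      using cmul[OF cmul_branch_generator, of s m] by simp
  qed
  from add[OF coordinates_reconstruct[OF assms] this] show "a \<in> L" by simp
qed (rule coordinates_L)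

text \<open>
  The coordinates of the two vertices that make up a generator differ by one basis vector, exactly
  and not only modulo the relations, because all exponents vanish at full length.
\<close>

lemma coordinates_surj:
  assumes "Poly_Mapping.keys c \<subseteq> branch_words n"
  obtains a where "Poly_Mapping.keys a \<subseteq> V" "coordinates a = c"
proof -
  have "\<exists>a. Poly_Mapping.keys a \<subseteq> V \<and> coordinates a = c"
    using assms
  proof (induction rule: free_Abelian_group_induct[consumes 1, case_names 1 2 3])
    case 1
    show ?case by (intro exI[of _ 0]) (simp add: coordinates_def)
  next
    case (2 x y)
    then obtain a b where "Poly_Mapping.keys a \<subseteq> V" "coordinates a = x"
      "Poly_Mapping.keys b \<subseteq> V" "coordinates b = y" by blast
    then show ?case
      using keys_diff[of a b]
      by (intro exI[of _ "a - b"]) (auto simp: coordinates_def frag_extend_diff)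
  next
    case (3 s)
    then obtain u where s: "s = u @ [True]" "length u + 1 < n"
      by (auto simp: branch_words_def)
    \<comment> \<open>These vertices continue \<open>s\<close> and its parent by zeros up to length \<open>n\<close>.\<close>
    let ?r = "False # s @ replicate (n - 1 - length s) False"
      and ?r' = "False # u @ replicate (n - 1 - length u) False"
    have w: "?r \<in> words n" "?r' \<in> words n" using s by (auto simp: words_def)
    have "coordinate n (False # t @ replicate (n - 1 - length t) False) = branch_sum t"
      if "length t < n" for t
      using that by simp
    from this[of s] this[of u] have "coordinate n ?r = branch_sum s" "coordinate n ?r' = branch_sum u"
      using s by auto
    then have "coordinates (basis ?r - basis ?r') = frag_of s"
      using w s coordinates_basis by (simp add: branch_sum_snoc coordinates_def frag_extend_diff)
    moreover have "Poly_Mapping.keys (basis ?r - basis ?r') \<subseteq> V"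
      using keys_diff[of "basis ?r" "basis ?r'"] w V by auto
    ultimately show ?case by blast
  qed
  then show ?thesis using that by blast
qed

end

lemma finite_branch_words: "finite (branch_words n)"
proof (rule finite_subset)
  show "branch_words n \<subseteq> {r. set r \<subseteq> UNIV \<and> length r \<le> n}"
    by (auto simp: branch_words_def)
  show "finite {r :: bool list. set r \<subseteq> UNIV \<and> length r \<le> n}"
    by (rule finite_lists_length_le) simp
qed

theorem theorem1p3:
  fixes n :: nat and v\<^sub>0 :: de_bruijn_label
  assumes "v\<^sub>0 \<in> verts (de_bruijn n)"
  shows "sandpile_group (de_bruijn n) v\<^sub>0 \<cong>
    sum_group {1..<n} (\<lambda>j. sum_group {..<(2::nat) ^ (n - 1 - j)} (\<lambda>_. integer_mod_group (2 ^ j)))"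
proof -
  obtain v where v\<^sub>0: "v\<^sub>0 = label v" "v \<in> words n"
    using assms de_bruijn_words[of n] by auto
  interpret de_bruijn_sandpile n v by unfold_locales (rule v\<^sub>0(2))
  have "\<exists>f. bij_betw f {..<(2::nat) ^ m} (words m)" for m
    using ex_bij_betw_nat_finite[OF finite_words, of m] by (simp add: card_words lessThan_atLeast0)
  then obtain enum where enum: "\<And>m. bij_betw (enum m) {..<(2::nat) ^ m} (words m)" by metis
  \<comment> \<open>The two-level index of the direct sum enumerates the words that index the cyclic summands.\<close>
  define s where "s j k = enum (n - 1 - j) k @ [True]" for j k
  let ?I = "\<lambda>j. {..<(2::nat) ^ (n - 1 - j)}"
  have length_s: "length (s j k) = n - j" and s_in: "s j k \<in> branch_words n"
    if "j \<in> {1..<n}" "k \<in> ?I j" for j k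
  proof -
    have "enum (n - 1 - j) k \<in> words (n - 1 - j)"
      using bij_betwE[OF enum] that by blast
    then show "length (s j k) = n - j" "s j k \<in> branch_words n"
      using that by (auto simp: s_def words_def branch_words_def)
  qed
  have s_surj: "\<exists>k \<in> ?I (n - length t). t = s (n - length t) k" "n - length t \<in> {1..<n}"
    if t: "t \<in> branch_words n" for t
  proof -
    obtain u where u: "t = u @ [True]" "length u + 1 < n"
      using t by (auto simp: branch_words_def)
    have "u \<in> enum (length u) ` {..<2 ^ length u}"
      using enum[of "length u"] by (auto simp: bij_betw_def words_def)
    moreover have "n - 1 - (n - length t) = length u" using u by simp
    ultimately show "\<exists>k \<in> ?I (n - length t). t = s (n - length t) k"
      using u(1) by (auto simp: s_def)
    show "n - length t \<in> {1..<n}" using u by auto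
  qed
  have s_inj: "k = k'" if "j \<in> {1..<n}" "k \<in> ?I j" "k' \<in> ?I j" "s j k = s j k'" for j k k'
    using that bij_betw_imp_inj_on[OF enum[of "n - 1 - j"]] by (auto simp: s_def dest: inj_onD)

  let ?C = "\<lambda>j. sum_group (?I j) (\<lambda>_. integer_mod_group (2 ^ j))"
  let ?T = "sum_group {1..<n} ?C"
  have carrier_T: "carrier ?T = (\<Pi>\<^sub>E j\<in>{1..<n}. \<Pi>\<^sub>E k\<in>?I j. {0..<2 ^ j})"
    by (simp add: carrier_sum_group carrier_integer_mod_group)
  define \<Phi> where "\<Phi> a = (\<lambda>j\<in>{1..<n}. \<lambda>k\<in>?I j. Poly_Mapping.lookup (coordinates a) (s j k) mod 2 ^ j)" for a
  have hom: "\<Phi> \<in> hom (free_Abelian_group V) ?T"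
  proof (rule homI)
    show "\<Phi> a \<in> carrier ?T" for a
      unfolding carrier_T \<Phi>_def by auto
    show "\<Phi> (a \<otimes>\<^bsub>free_Abelian_group V\<^esub> b) = \<Phi> a \<otimes>\<^bsub>?T\<^esub> \<Phi> b" for a b
      by (auto simp: \<Phi>_def coordinates_def frag_extend_add Poly_Mapping.lookup_add mod_add_eq fun_eq_iff restrict_def)
  qed
  then interpret \<Phi>: group_hom "free_Abelian_group V" ?T \<Phi>
    by (intro group_hom.intro group_hom_axioms.intro group_free_Abelian_group sum_group
        group_integer_mod_group)
  have kernel: "kernel (free_Abelian_group V) ?T \<Phi> = L"
  proof -
    have trivial: "\<Phi> a = \<one>\<^bsub>?T\<^esub> \<longleftrightarrow> coordinates a \<in> relation_lattice n" if "Poly_Mapping.keys a \<subseteq> V" for a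
    proof -
      have "\<Phi> a = \<one>\<^bsub>?T\<^esub> \<longleftrightarrow>
          (\<forall>j\<in>{1..<n}. \<forall>k\<in>?I j. 2 ^ j dvd Poly_Mapping.lookup (coordinates a) (s j k))"
        by (auto simp: \<Phi>_def fun_eq_iff restrict_def dvd_eq_mod_eq_0)
      also have "\<dots> \<longleftrightarrow> (\<forall>t\<in>branch_words n. 2 ^ (n - length t) dvd Poly_Mapping.lookup (coordinates a) t)"
      proof (intro iffI ballI)
        fix t assume *: "\<forall>j\<in>{1..<n}. \<forall>k\<in>?I j. 2 ^ j dvd Poly_Mapping.lookup (coordinates a) (s j k)"
          and "t \<in> branch_words n"
        then show "2 ^ (n - length t) dvd Poly_Mapping.lookup (coordinates a) t"
          using s_surj[of t] by metis
      next
        fix j k assume *: "\<forall>t\<in>branch_words n. 2 ^ (n - length t) dvd Poly_Mapping.lookup (coordinates a) t"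
          and jk: "j \<in> {1..<n}" "k \<in> ?I j"
        have "n - length (s j k) = j" using length_s[OF jk] jk by simp
        then show "2 ^ j dvd Poly_Mapping.lookup (coordinates a) (s j k)"
          using * s_in[OF jk] by metis
      qed
      also have "\<dots> \<longleftrightarrow> coordinates a \<in> relation_lattice n"
        using keys_coordinates[OF that] unfolding relation_lattice_def
        by (auto simp: in_keys_iff subset_iff) (metis dvd_0_right)
      finally show ?thesis .
    qed
    have keys_L: "Poly_Mapping.keys a \<subseteq> V" if "a \<in> L" for a
      using subgroup.mem_carrier[OF subgroup_L that] by simp
    show ?thesis
    proof (rule Set.set_eqI)
      show "a \<in> kernel (free_Abelian_group V) ?T \<Phi> \<longleftrightarrow> a \<in> L" for a
        unfolding kernel_def mem_Collect_eq carrier_free_Abelian_group_iff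
        using trivial[of a] keys_L[of a] L_iff[of a] by argo
    qed
  qed
  have surj: "\<Phi> ` carrier (free_Abelian_group V) = carrier ?T"
  proof (intro equalityI subsetI)
    fix y assume "y \<in> \<Phi> ` carrier (free_Abelian_group V)"
    then obtain a where a: "a \<in> carrier (free_Abelian_group V)" "y = \<Phi> a" by (rule imageE)
    show "y \<in> carrier ?T" unfolding a(2) using a(1) by (rule \<Phi>.hom_closed)
  next
    fix y assume y: "y \<in> carrier ?T"
    define g where "g t = y (n - length t) (THE k. k \<in> ?I (n - length t) \<and> t = s (n - length t) k)" for t
    define c where "c = (\<Sum>t\<in>branch_words n. frag_cmul (g t) (frag_of t))"
    have "Poly_Mapping.keys c \<subseteq> branch_words n"
      unfolding c_def by (rule order_trans[OF keys_sum]) auto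
    then obtain a where a: "Poly_Mapping.keys a \<subseteq> V" "coordinates a = c"
      by (rule coordinates_surj)
    have "Poly_Mapping.lookup c t = g t" if "t \<in> branch_words n" for t
      using that finite_branch_words[of n]
      by (simp add: c_def lookup_sum if_distrib[of "\<lambda>x. _ * x"] sum.delta cong: if_cong)
    moreover have "g (s j k) = y j k" if jk: "j \<in> {1..<n}" "k \<in> ?I j" for j k
    proof -
      have "n - length (s j k) = j" using length_s[OF jk] jk by simp
      moreover have "(THE k'. k' \<in> ?I j \<and> s j k = s j k') = k"
        using jk s_inj by (intro the_equality) blast+
      ultimately show ?thesis by (simp add: g_def)
    qed
    ultimately have "Poly_Mapping.lookup c (s j k) = y j k" if "j \<in> {1..<n}" "k \<in> ?I j" for j k
      using s_in that by simp
    moreover have "y j k mod 2 ^ j = y j k" if "j \<in> {1..<n}" "k \<in> ?I j" for j k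
      using y that unfolding carrier_T by (intro mod_pos_pos_trivial) (fastforce simp: PiE_iff)+
    ultimately have "\<Phi> a = (\<lambda>j\<in>{1..<n}. \<lambda>k\<in>?I j. y j k)"
      by (auto simp: \<Phi>_def a(2) fun_eq_iff restrict_def)
    also have "\<dots> = y"
      using y unfolding carrier_T by (auto simp: PiE_iff extensional_def fun_eq_iff restrict_def)
    finally show "y \<in> \<Phi> ` carrier (free_Abelian_group V)" using a by auto
  qed
  show ?thesis
    using \<Phi>.FactGroup_iso[OF surj] unfolding kernel v\<^sub>0(1) sandpile_group_def .
qed

end
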